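(* Let $L\ne\{0,1\}$ be a lattice domain. Suppose that $L$ is generated by a set $G$ such that $(ab:a)\le\sqrt{b}$ for every $a,b\in G\setminus\{0\}$. The following are equivalent. (i) $ab$ has a CQ-factorization for every $a,b\in G\setminus\{1\}$. (ii) $L$ is one-dimensional and $\mathrm{Min}(a)$ is finite for each $a\in L$. (iii) $L$ is a CQ-lattice.
   Context: A multiplicative lattice is an ordered commutative monoid $(L,\le,\cdot)$ such that $(L,\le)$ is a complete lattice with top element $1$ and bottom element $0$, $0\ne 1$; $x(\bigvee Y)=\bigvee_{y\in Y}xy$ for all $x\in L$, $Y\subseteq L$; and $x1=x$ for all $x\in L$. An element $c\in L$ is compact if $c\le\bigvee H$ with $H\subseteq L$ implies $c\le\bigvee F$ for some finite $F\subseteq H$. A subset $G\subseteq L$ generates $L$ if every element of $L$ is the join of some subset of $G$. Throughout, "lattice" means a multiplicative lattice $L$ such that (i) $1$ is compact, (ii) $L$ is generated by the set of its compact elements, (iii) every product of two compact elements is compact. An element $p\ne 1$ is prime if $xy\le p$ implies $x\le p$ or $y\le p$. $L$ is a lattice domain if it is a lattice and $0$ is prime. $\mathrm{Min}(a)$ is the set of minimal primes over $a$, i.e. minimal elements of the set of prime elements $p\ge a$. The dimension of $L$ is the supremum of the integers $n\ge 0$ such that there is a chain of prime elements $p_0<p_1<\dots<p_n$. The radical of $a\in L$ is $\sqrt{a}=\bigvee\{x\in L : x^n\le a \text{ for some } n\ge 1\}$. An element $q\ne 1$ is primary if $xy\le q$ implies $x\le q$ or $y\le\sqrt{q}$. For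 $x,y\in L$, $(y:x)=\bigvee\{a\in L : ax\le y\}$. Elements $a,b\in L$ are comaximal if $a\vee b=1$. For $a\in L\setminus\{1\}$, a CQ-factorization (comaximal primary factorization) of $a$ is a factorization $a=a_1\cdots a_n$ ($n\ge1$) with $a_1,\dots,a_n\in L\setminus\{1\}$ pairwise comaximal and each $a_i$ primary. $L$ is a CQ-lattice if every $x\in L\setminus\{1\}$ has a CQ-factorization. *)

theory Defs
  imports Main "HOL-Library.Extended_Nat"
begin

definition (in complete_lattice) compact_element :: "'a \<Rightarrow> bool" where
  "compact_element c \<longleftrightarrow> (\<forall>H. c \<le> Sup H \<longrightarrow> (\<exists>F. finite F \<and> F \<subseteq> H \<and> c \<le> Sup F))"

definition (in complete_lattice) generates :: "'a set \<Rightarrow> bool" where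
  "generates G \<longleftrightarrow> (\<forall>x. \<exists>S. S \<subseteq> G \<and> x = Sup S)"

text \<open>The element written $0$ in the literature is \<open>bot\<close>; the top element is the monoid unit
  \<open>1\<close>.  The lattice is the whole type.\<close>

class multiplicative_lattice = complete_lattice + comm_monoid_mult +
  assumes mult_mono_left: "x \<le> y \<Longrightarrow> z * x \<le> z * y"
    and top_eq_one: "top = 1"
    and bot_neq_one: "bot \<noteq> 1"
    and mult_Sup: "x * Sup Y = (SUP y\<in>Y. x * y)"
begin

definition prime_element :: "'a \<Rightarrow> bool" where
  "prime_element p \<longleftrightarrow> p \<noteq> 1 \<and> (\<forall>x y. x * y \<le> p \<longrightarrow> x \<le> p \<or> y \<le> p)"

definition Min_primes :: "'a \<Rightarrow> 'a set" where
  "Min_primes a =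
     {p. prime_element p \<and> a \<le> p \<and> (\<forall>q. prime_element q \<and> a \<le> q \<and> q \<le> p \<longrightarrow> q = p)}"

definition radical :: "'a \<Rightarrow> 'a" where
  "radical a = Sup {x. \<exists>n\<ge>1. x ^ n \<le> a}"

definition primary_element :: "'a \<Rightarrow> bool" where
  "primary_element q \<longleftrightarrow> q \<noteq> 1 \<and> (\<forall>x y. x * y \<le> q \<longrightarrow> x \<le> q \<or> y \<le> radical q)"

text \<open>\<open>residual y x\<close> is $(y : x)$.\<close>

definition residual :: "'a \<Rightarrow> 'a \<Rightarrow> 'a" where
  "residual y x = Sup {a. a * x \<le> y}"

definition comaximal :: "'a \<Rightarrow> 'a \<Rightarrow> bool" where
  "comaximal a b \<longleftrightarrow> sup a b = 1"

definition CQ_factorization :: "'a \<Rightarrow> 'a list \<Rightarrow> bool" where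
  "CQ_factorization a as \<longleftrightarrow>
     as \<noteq> [] \<and> a = prod_list as \<and>
     (\<forall>i < length as. as ! i \<noteq> 1 \<and> primary_element (as ! i)) \<and>
     (\<forall>i < length as. \<forall>j < length as. i \<noteq> j \<longrightarrow> comaximal (as ! i) (as ! j))"

definition has_CQ_factorization :: "'a \<Rightarrow> bool" where
  "has_CQ_factorization a \<longleftrightarrow> (\<exists>as. CQ_factorization a as)"

end

text \<open>The supremum is taken in the extended naturals, so unbounded chain lengths give \<open>\<infinity>\<close>.\<close>

definition dimension :: "'a::multiplicative_lattice itself \<Rightarrow> enat" where
  "dimension _ =
     Sup {enat n | n. \<exists>p :: nat \<Rightarrow> 'a.
            (\<forall>i\<le>n. prime_element (p i)) \<and> (\<forall>i<n. p i < p (Suc i))}"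

class compactly_generated_mult_lattice = multiplicative_lattice +
  assumes compact_one: "compact_element 1"
    and generates_compact: "generates {c. compact_element c}"
    and compact_mult: "compact_element c \<Longrightarrow> compact_element d \<Longrightarrow> compact_element (c * d)"

class lattice_domain = compactly_generated_mult_lattice +
  assumes prime_bot: "prime_element bot"

definition CQ_lattice :: "'a::compactly_generated_mult_lattice itself \<Rightarrow> bool" where
  "CQ_lattice _ \<longleftrightarrow> (\<forall>x::'a. x \<noteq> 1 \<longrightarrow> has_CQ_factorization x)"

end

theory Submission
  imports Defs
begin

text \<open>
  The engine is prime separation (\<open>prime_separation\<close>): a multiplicatively closed set of compact
  elements, none of which lies below \<open>x\<close>, is avoided by some prime above \<open>x\<close>.

  A factorization into pairwise comaximal primary elements is a statement about localizations.  At
  most one factor lies below a given prime, so if \<open>a * b\<close> is such a product and lies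
  below a prime \<open>m\<close>, then \<open>a * b = s * q\<close> where \<open>q\<close> is primary and \<open>s\<close>, the product of the
  other factors, is not below \<open>m\<close>.  Suppose there were primes \<open>bot < p < m\<close>.  Generators \<open>a \<noteq> bot\<close>
  below \<open>p\<close>, and \<open>b\<close> below \<open>m\<close> but not below \<open>p\<close>, then give a contradiction: \<open>p\<close> lies above
  \<open>q\<close> and hence above its radical, which therefore is not above \<open>b\<close>, so that \<open>a \<le> q\<close> by
  primariness.  Hence \<open>s * a \<le> a * b\<close>, and the hypothesis on residuals puts \<open>s\<close> below the
  radical of \<open>b\<close>, so below \<open>m\<close>.  Thus nonzero primes are maximal
  (\<open>prime_eq_if_generators_factor\<close>), and the primes above a nonzero \<open>a\<close> are among the radicals
  of the finitely many factors of \<open>g * g\<close>, for any nonzero generator \<open>g\<close> below \<open>a\<close>.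

  Conversely, if \<open>x\<close> has only finitely many primes above it and these are pairwise incomparable,
  then \<open>x\<close> is the meet of its localizations at them (\<open>Inf_components_le\<close>).  Incomparability
  makes each localization primary (\<open>primary_component\<close>) and any two of them comaximal
  (\<open>comaximal_components\<close>), and a finite meet of pairwise comaximal elements is their product.
\<close>

section \<open>Arithmetic of multiplicative lattices\<close>

lemma mult_sup_distrib:
  fixes x y z :: "'a::multiplicative_lattice"
  shows "z * sup x y = sup (z * x) (z * y)"
  using mult_Sup[of z "{x, y}"] by simp

lemma mult_mono_lattice:
  fixes x y z w :: "'a::multiplicative_lattice"
  assumes "x \<le> y" "z \<le> w"
  shows "x * z \<le> y * w"
  by (metis assms mult_mono_left mult.commute order_trans)

lemma le_one_lattice [simp]: "(x::'a::multiplicative_lattice) \<le> 1"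
  by (metis top_eq_one top_greatest)

lemma one_le_iff [simp]: "1 \<le> (x::'a::multiplicative_lattice) \<longleftrightarrow> x = 1"
  by (simp add: order_eq_iff)

lemma mult_le_left: "x * y \<le> (x::'a::multiplicative_lattice)"
  using mult_mono_left[of y 1 x] by simp

lemma mult_le_right: "x * y \<le> (y::'a::multiplicative_lattice)"
  using mult_le_left[of y x] by (simp add: mult.commute)

lemma generator_below_not_below:
  assumes "generates G" "\<not> a \<le> (b::'a::complete_lattice)"
  obtains g where "g \<in> G" "g \<le> a" "\<not> g \<le> b"
proof -
  obtain S where "S \<subseteq> G" "a = Sup S"
    using assms(1) unfolding generates_def by blast
  then show ?thesis
    using assms(2) that by (metis Sup_least Sup_upper subsetD)
qed

lemma compact_below_not_below:
  assumes "\<not> a \<le> (b::'a::compactly_generated_mult_lattice)"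
  obtains c where "compact_element c" "c \<le> a" "\<not> c \<le> b"
  using generator_below_not_below[OF generates_compact assms] by blast

lemma compact_power:
  "compact_element (c::'a::compactly_generated_mult_lattice) \<Longrightarrow> compact_element (c ^ n)"
  by (induction n) (auto intro: compact_one compact_mult)

lemma comaximal_mult:
  fixes a b c :: "'a::multiplicative_lattice"
  assumes "comaximal a b" "comaximal a c"
  shows "comaximal a (b * c)"
proof -
  have "1 = sup a b * sup a c"
    using assms by (simp add: comaximal_def)
  also have "\<dots> = sup (sup a b * a) (sup (a * c) (b * c))"
    by (simp only: mult_sup_distrib mult.commute[of _ c])
  also have "\<dots> \<le> sup a (b * c)"
    using mult_le_right[of "sup a b" a] mult_le_left[of a c]
    by (meson le_supI le_supI1 sup.cobounded2)
  finally show ?thesis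
    by (simp add: comaximal_def)
qed

lemma comaximal_inf_le_mult:
  fixes a b :: "'a::multiplicative_lattice"
  assumes "comaximal a b"
  shows "inf a b \<le> a * b"
proof -
  have "inf a b = inf a b * sup a b"
    using assms by (simp add: comaximal_def)
  also have "\<dots> = sup (inf a b * a) (inf a b * b)"
    by (rule mult_sup_distrib)
  also have "\<dots> \<le> a * b"
    by (metis inf.cobounded1 inf.cobounded2 le_supI mult.commute mult_mono_left)
  finally show ?thesis .
qed

lemma comaximal_prod_list:
  fixes a :: "'a::multiplicative_lattice"
  assumes "\<And>b. b \<in> set bs \<Longrightarrow> comaximal a b"
  shows "comaximal a (prod_list bs)"
  using assms
proof (induction bs)
  case Nil
  then show ?case
    using sup.cobounded2[of "1::'a" a] by (simp add: comaximal_def sup_absorb2)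
qed (simp add: comaximal_mult)

lemma prod_list_eq_Inf_if_comaximal:
  fixes f :: "'b \<Rightarrow> 'a::multiplicative_lattice"
  assumes "distinct ms"
    and "\<And>m n. m \<in> set ms \<Longrightarrow> n \<in> set ms \<Longrightarrow> m \<noteq> n \<Longrightarrow> comaximal (f m) (f n)"
  shows "prod_list (map f ms) = (INF m\<in>set ms. f m)"
  using assms
proof (induction ms)
  case Nil
  then show ?case by (simp add: top_eq_one)
next
  case (Cons m ms)
  have IH: "prod_list (map f ms) = (INF m\<in>set ms. f m)"
    using Cons by simp
  have "comaximal (f m) (prod_list (map f ms))"
    by (rule comaximal_prod_list) (use Cons.prems in auto)
  then have "f m * prod_list (map f ms) = inf (f m) (prod_list (map f ms))"
    by (meson antisym comaximal_inf_le_mult le_inf_iff mult_le_left mult_le_right)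
  then show ?case
    using IH by simp
qed

section \<open>Primes, radicals and prime separation\<close>

lemma prime_elementD:
  "prime_element p \<Longrightarrow> x * y \<le> p \<Longrightarrow> x \<le> p \<or> y \<le> (p::'a::multiplicative_lattice)"
  by (simp add: prime_element_def)

lemma prime_power_le:
  fixes p :: "'a::multiplicative_lattice"
  assumes "prime_element p" "x ^ n \<le> p"
  shows "x \<le> p"
  using assms(2)
proof (induction n)
  case 0
  then show ?case using assms(1) by (simp add: prime_element_def)
qed (use assms(1) prime_elementD in auto)

lemma radical_le_prime:
  fixes p :: "'a::multiplicative_lattice"
  assumes "prime_element p" "a \<le> p"
  shows "radical a \<le> p"
  unfolding radical_def
  by (rule Sup_least) (use assms prime_power_le order_trans in blast)

lemma le_radical: "(a::'a::multiplicative_lattice) \<le> radical a"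
  unfolding radical_def by (rule Sup_upper) (auto intro!: exI[of _ "1::nat"])

lemma prime_prod_list_le:
  fixes p :: "'a::multiplicative_lattice"
  assumes "prime_element p" "prod_list as \<le> p"
  shows "\<exists>a \<in> set as. a \<le> p"
  using assms(2)
proof (induction as)
  case Nil
  then show ?case using assms(1) by (simp add: prime_element_def)
qed (use assms(1) prime_elementD in auto)

text \<open>An element that is maximal among those above \<open>x\<close> and avoiding \<open>S\<close> is prime: if it
  contained a product but neither factor, adjoining each factor would catch elements of \<open>S\<close>
  whose product it contains.  Compactness is what lets joins of chains still avoid \<open>S\<close>.\<close>

lemma prime_separation:
  fixes x :: "'a::multiplicative_lattice"
  assumes compact: "\<And>s. s \<in> S \<Longrightarrow> compact_element s"
    and closed: "\<And>s t. s \<in> S \<Longrightarrow> t \<in> S \<Longrightarrow> s * t \<in> S"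
    and "S \<noteq> {}"
    and avoid: "\<And>s. s \<in> S \<Longrightarrow> \<not> s \<le> x"
  obtains p where "prime_element p" "x \<le> p" "\<And>s. s \<in> S \<Longrightarrow> \<not> s \<le> p"
proof -
  define A where "A = {y. x \<le> y \<and> (\<forall>s\<in>S. \<not> s \<le> y)}"
  have "\<exists>u\<in>A. \<forall>y\<in>C. y \<le> u" if C: "C \<in> Chains (relation_of (\<le>) A)" for C
  proof (cases "C = {}")
    case True
    then show ?thesis using avoid by (auto simp: A_def)
  next
    case False
    have CA: "C \<subseteq> A" and total: "\<And>y z. y \<in> C \<Longrightarrow> z \<in> C \<Longrightarrow> y \<le> z \<or> z \<le> y"
      using C by (auto simp: Chains_def relation_of_def)
    have bounded: "\<exists>u\<in>C. Sup F \<le> u" if "finite F" "F \<subseteq> C" for F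
      using that
    proof (induction F)
      case empty
      then show ?case using False by auto
    next
      case (insert y F)
      then obtain u where "u \<in> C" "Sup F \<le> u" "y \<in> C" by auto
      then show ?case
        using total[of y u] by (metis Sup_insert le_sup_iff order_refl order_trans)
    qed
    have "\<not> s \<le> Sup C" if s: "s \<in> S" for s
    proof
      assume "s \<le> Sup C"
      then obtain F where "finite F" "F \<subseteq> C" "s \<le> Sup F"
        using compact[OF s] unfolding compact_element_def by blast
      then show False
        using bounded CA s unfolding A_def by (blast intro: order_trans)
    qed
    moreover have "x \<le> Sup C"
      using False CA by (auto simp: A_def intro: Sup_upper2)
    ultimately have "Sup C \<in> A"
      by (simp add: A_def)
    then show ?thesis
      by (auto intro: Sup_upper)
  qed
  moreover have "partial_order_on A (relation_of (\<le>) A)"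
    by (auto simp: relation_of_def partial_order_on_def preorder_on_def refl_on_def trans_def antisym_def)
  ultimately obtain p where p: "p \<in> A" and max: "\<And>y. y \<in> A \<Longrightarrow> p \<le> y \<Longrightarrow> y = p"
    using predicate_Zorn[of A "(\<le>)"] by blast
  have caught: "\<exists>s\<in>S. s \<le> sup p u" if "\<not> u \<le> p" for u
  proof -
    have "sup p u \<notin> A"
      using that max[of "sup p u"] by (metis sup_ge1 sup_ge2)
    then show ?thesis
      using p by (auto simp: A_def le_supI1)
  qed
  have "prime_element p"
    unfolding prime_element_def
  proof (intro conjI allI impI)
    show "p \<noteq> 1"
      using p \<open>S \<noteq> {}\<close> by (auto simp: A_def)
    fix u v
    assume uv: "u * v \<le> p"
    show "u \<le> p \<or> v \<le> p"
    proof (rule ccontr)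
      assume "\<not> (u \<le> p \<or> v \<le> p)"
      then obtain s t where st: "s \<in> S" "t \<in> S" "s \<le> sup p u" "t \<le> sup p v"
        using caught by blast
      have "s * t \<le> sup p u * sup p v"
        using st by (intro mult_mono_lattice)
      also have "\<dots> = sup (sup p u * p) (sup (p * v) (u * v))"
        by (simp only: mult_sup_distrib mult.commute[of _ v])
      also have "\<dots> \<le> p"
        using uv by (simp add: mult_le_left mult_le_right)
      finally show False
        using p closed st by (auto simp: A_def)
    qed
  qed
  with p that show ?thesis by (auto simp: A_def)
qed

lemma exists_prime_above:
  assumes "(x::'a::compactly_generated_mult_lattice) \<noteq> 1"
  obtains p where "prime_element p" "x \<le> p"
  using prime_separation[of "{1}" x] compact_one assms by auto

lemma comaximal_if_no_common_prime:
  fixes a b :: "'a::compactly_generated_mult_lattice"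
  assumes "\<And>p. prime_element p \<Longrightarrow> a \<le> p \<Longrightarrow> \<not> b \<le> p"
  shows "comaximal a b"
  unfolding comaximal_def using assms by (metis exists_prime_above le_sup_iff)

text \<open>Separating the powers of \<open>c\<close> from \<open>a\<close> by a prime replaces the multinomial expansion of
  a power of a finite join of elements nilpotent modulo \<open>a\<close>.\<close>

lemma compact_le_radicalE:
  fixes c :: "'a::compactly_generated_mult_lattice"
  assumes "compact_element c" "c \<le> radical a"
  obtains n where "c ^ n \<le> a"
proof (rule ccontr)
  assume "\<not> thesis"
  then have no_power: "\<And>n. \<not> c ^ n \<le> a"
    using that by blast
  obtain p where "prime_element p" "a \<le> p" "\<And>s. s \<in> range ((^) c) \<Longrightarrow> \<not> s \<le> p"
  proof (rule prime_separation[of "range ((^) c)" a])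
    fix s t assume "s \<in> range ((^) c)" "t \<in> range ((^) c)"
    then show "s * t \<in> range ((^) c)"
      by (auto simp flip: power_add)
  qed (use assms(1) compact_power no_power in auto)
  then show False
    using assms(2) radical_le_prime[of p a] by (metis order_trans power_one_right rangeI)
qed

lemma prime_radical_of_primary:
  fixes q :: "'a::compactly_generated_mult_lattice"
  assumes q: "primary_element q"
  shows "prime_element (radical q)"
  unfolding prime_element_def
proof (intro conjI allI impI)
  have "q \<noteq> 1"
    using q by (simp add: primary_element_def)
  then show "radical q \<noteq> 1"
    by (metis exists_prime_above radical_le_prime one_le_iff prime_element_def)
  fix x y
  assume xy: "x * y \<le> radical q"
  show "x \<le> radical q \<or> y \<le> radical q"
  proof (rule ccontr)
    assume "\<not> (x \<le> radical q \<or> y \<le> radical q)"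
    then obtain c d where c: "compact_element c" "c \<le> x" "\<not> c \<le> radical q"
      and d: "compact_element d" "d \<le> y" "\<not> d \<le> radical q"
      by (metis compact_below_not_below)
    have root: "z \<le> radical q" if "z ^ n \<le> q" for z n
    proof -
      have "z ^ Suc n \<le> q"
        using that mult_le_right[of z "z ^ n"] by (simp add: order_trans)
      then show ?thesis
        unfolding radical_def by (intro Sup_upper) (auto intro!: exI[of _ "Suc n"])
    qed
    have "c * d \<le> radical q"
      using c d xy by (meson mult_mono_lattice order_trans)
    then obtain n where "(c * d) ^ n \<le> q"
      using c d by (meson compact_le_radicalE compact_mult)
    then have "c ^ n \<le> q \<or> d ^ n \<le> radical q"
      using q by (simp add: primary_element_def power_mult_distrib)
    moreover have "compact_element (d ^ n)"
      using d compact_power by blast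
    ultimately obtain k where "c ^ n \<le> q \<or> d ^ (n * k) \<le> q"
      by (metis compact_le_radicalE power_mult)
    then show False
      using root c d by blast
  qed
qed

section \<open>Localization\<close>

text \<open>In the lattice of ideals of a commutative ring this is the contraction to the ring of the
  localization of the ideal \<open>x\<close> at the prime \<open>m\<close>.\<close>

definition component :: "'a::multiplicative_lattice \<Rightarrow> 'a \<Rightarrow> 'a" where
  "component x m = Sup {y. \<exists>s. \<not> s \<le> m \<and> s * y \<le> x}"

lemma le_componentI: "\<not> s \<le> m \<Longrightarrow> s * y \<le> x \<Longrightarrow> y \<le> component x m"
  unfolding component_def by (rule Sup_upper) blast

lemma le_component:
  assumes "prime_element m"
  shows "x \<le> component x m"
  using assms by (intro le_componentI[of 1]) (auto simp: prime_element_def)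

lemma component_le_prime:
  assumes "prime_element m" "x \<le> m"
  shows "component x m \<le> m"
  unfolding component_def
  by (rule Sup_least) (use assms prime_elementD order_trans in blast)

text \<open>One multiplier serves finitely many elements, since multipliers can be multiplied
  together; by compactness only finitely many matter.\<close>

lemma compact_le_componentE:
  assumes m: "prime_element m" and y: "compact_element y" "y \<le> component x m"
  obtains s where "\<not> s \<le> m" "s * y \<le> x"
proof -
  obtain F where F: "finite F" "F \<subseteq> {y. \<exists>s. \<not> s \<le> m \<and> s * y \<le> x}" "y \<le> Sup F"
    using y unfolding component_def compact_element_def by blast
  have "\<exists>s. \<not> s \<le> m \<and> s * Sup F \<le> x"
    using F(1,2)
  proof (induction F)
    case empty
    have "(1::'a) * Sup {} \<le> x"
      by simp
    then show ?case
      using m unfolding prime_element_def by (metis one_le_iff)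
  next
    case (insert z F)
    then obtain s t where st: "\<not> s \<le> m" "s * Sup F \<le> x" "\<not> t \<le> m" "t * z \<le> x"
      by auto
    have "(t * s) * z \<le> x" "(t * s) * Sup F \<le> x"
      using st mult_le_left[of "t * z" s] mult_le_right[of t "s * Sup F"]
      by (auto simp: ac_simps intro: order_trans)
    then have "(t * s) * Sup (insert z F) \<le> x"
      by (simp add: mult_sup_distrib)
    then show ?case
      using st m prime_elementD by blast
  qed
  then show ?thesis
    using that F(3) by (meson mult_mono_left order_trans)
qed

text \<open>An element is determined by its localizations: the residual of \<open>x\<close> by a compact \<open>y\<close>
  below all of them lies under no prime above \<open>x\<close>, so it is \<open>1\<close>.\<close>

lemma Inf_components_le:
  fixes x :: "'a::compactly_generated_mult_lattice"
  shows "(INF m\<in>{p. prime_element p \<and> x \<le> p}. component x m) \<le> x" (is "?I \<le> x")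
proof (rule ccontr)
  assume "\<not> ?I \<le> x"
  then obtain y where y: "compact_element y" "y \<le> ?I" "\<not> y \<le> x"
    by (rule compact_below_not_below)
  have res: "y * residual x y \<le> x"
    unfolding residual_def by (auto simp: mult_Sup mult.commute intro: SUP_least)
  have "residual x y \<noteq> 1"
    using res y by auto
  then obtain m where m: "prime_element m" "residual x y \<le> m"
    by (rule exists_prime_above)
  have "x \<le> residual x y"
    unfolding residual_def by (rule Sup_upper) (simp add: mult_le_left)
  then have "x \<le> m"
    using m by simp
  then have "y \<le> component x m"
    using y(2) m by (auto intro: order_trans INF_lower)
  then obtain s where "\<not> s \<le> m" "s * y \<le> x"
    using m y by (meson compact_le_componentE)
  moreover from this have "s \<le> residual x y"
    unfolding residual_def by (intro Sup_upper) simp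
  ultimately show False
    using m by simp
qed

text \<open>Otherwise the products of powers of \<open>y\<close> with elements not below \<open>m\<close> could be separated
  from \<open>x\<close> by a prime, which would lie below \<open>m\<close> and differ from it.\<close>

lemma power_le_component:
  fixes x m y :: "'a::compactly_generated_mult_lattice"
  assumes m: "prime_element m"
    and minimal: "\<And>p. prime_element p \<Longrightarrow> x \<le> p \<Longrightarrow> p \<le> m \<Longrightarrow> p = m"
    and y: "compact_element y" "y \<le> m"
  obtains k where "y ^ k \<le> component x m"
proof (rule ccontr)
  assume "\<not> thesis"
  then have none: "\<And>k. \<not> y ^ k \<le> component x m"
    using that by blast
  define S where "S = {s * y ^ k | s k. compact_element s \<and> \<not> s \<le> m}"
  have one: "\<not> 1 \<le> m"
    using m by (simp add: prime_element_def)
  obtain p where p: "prime_element p" "x \<le> p" "\<And>s. s \<in> S \<Longrightarrow> \<not> s \<le> p"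
  proof (rule prime_separation[of S x])
    fix s assume "s \<in> S"
    then show "compact_element s" "\<not> s \<le> x"
      using y none by (auto simp: S_def intro: compact_mult compact_power dest: le_componentI)
  next
    fix s t assume "s \<in> S" "t \<in> S"
    then obtain a b i j where "s = a * y ^ i" "t = b * y ^ j" "compact_element a"
      "compact_element b" "\<not> a \<le> m" "\<not> b \<le> m"
      unfolding S_def by blast
    then have "s * t = (a * b) * y ^ (i + j)" "compact_element (a * b)" "\<not> a * b \<le> m"
      using m prime_elementD compact_mult by (auto simp: power_add ac_simps)
    then show "s * t \<in> S"
      unfolding S_def by blast
  next
    have "1 * y ^ 0 \<in> S"
      using one compact_one unfolding S_def
      by (intro CollectI exI[of _ "1::'a"] exI[of _ "0::nat"]) simp
    then show "S \<noteq> {}"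
      by blast
  qed blast
  have "p \<le> m"
  proof (rule ccontr)
    assume "\<not> p \<le> m"
    then obtain c where c: "compact_element c" "c \<le> p" "\<not> c \<le> m"
      by (rule compact_below_not_below)
    then have "c * y ^ 0 \<in> S"
      unfolding S_def by blast
    then show False
      using p c by simp
  qed
  moreover have "1 * y ^ 1 \<in> S"
    unfolding S_def using one compact_one by blast
  ultimately show False
    using minimal p y by fastforce
qed

lemma prime_above_component:
  fixes x m p :: "'a::compactly_generated_mult_lattice"
  assumes m: "prime_element m"
    and minimal: "\<And>p. prime_element p \<Longrightarrow> x \<le> p \<Longrightarrow> p \<le> m \<Longrightarrow> p = m"
    and p: "prime_element p" "component x m \<le> p"
  shows "m \<le> p"
proof (rule ccontr)
  assume "\<not> m \<le> p"
  then obtain y where y: "compact_element y" "y \<le> m" "\<not> y \<le> p"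
    by (rule compact_below_not_below)
  then obtain k where "y ^ k \<le> component x m"
    using power_le_component m minimal by metis
  then show False
    using p y by (meson order_trans prime_power_le)
qed

text \<open>The only prime above the localization at \<open>m\<close> is \<open>m\<close> itself, so an element not below
  \<open>m\<close> is comaximal to that localization and can be cancelled modulo it.\<close>

lemma primary_component:
  fixes x m :: "'a::compactly_generated_mult_lattice"
  assumes m: "prime_element m" "x \<le> m"
    and incomparable:
      "\<And>p q. prime_element p \<Longrightarrow> prime_element q \<Longrightarrow> x \<le> p \<Longrightarrow> p \<le> q \<Longrightarrow> p = q"
  shows "primary_element (component x m)" (is "primary_element ?q")
  unfolding primary_element_def
proof (intro conjI allI impI)
  show "?q \<noteq> 1"
    using component_le_prime[OF m] m by (auto simp: prime_element_def)
  fix a b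
  assume ab: "a * b \<le> ?q"
  show "a \<le> ?q \<or> b \<le> radical ?q"
  proof (cases "b \<le> m")
    case True
    have "m \<le> radical ?q"
    proof (rule ccontr)
      assume "\<not> m \<le> radical ?q"
      then obtain y where y: "compact_element y" "y \<le> m" "\<not> y \<le> radical ?q"
        by (rule compact_below_not_below)
      then obtain k where "y ^ k \<le> ?q"
        using power_le_component[of m x y] m incomparable by blast
      then have "y ^ Suc k \<le> ?q"
        using mult_le_right[of y "y ^ k"] by (simp add: order_trans)
      then have "y \<le> radical ?q"
        unfolding radical_def by (intro Sup_upper) (auto intro!: exI[of _ "Suc k"])
      with y show False by simp
    qed
    with True show ?thesis
      using order_trans by blast
  next
    case False
    have "comaximal ?q b"
    proof (rule comaximal_if_no_common_prime)
      fix p assume p: "prime_element p" "?q \<le> p"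
      then have "m = p"
        using prime_above_component[of m x p] m incomparable by blast
      with False show "\<not> b \<le> p" by simp
    qed
    then have "a = sup (a * ?q) (a * b)"
      by (metis comaximal_def mult.right_neutral mult_sup_distrib)
    also have "\<dots> \<le> ?q"
      using ab by (simp add: mult_le_right)
    finally show ?thesis ..
  qed
qed

lemma comaximal_components:
  fixes x m n :: "'a::compactly_generated_mult_lattice"
  assumes m: "prime_element m" "x \<le> m" and n: "prime_element n" "x \<le> n" and "m \<noteq> n"
    and incomparable:
      "\<And>p q. prime_element p \<Longrightarrow> prime_element q \<Longrightarrow> x \<le> p \<Longrightarrow> p \<le> q \<Longrightarrow> p = q"
  shows "comaximal (component x m) (component x n)"
proof (rule comaximal_if_no_common_prime, rule notI)
  fix p assume p: "prime_element p" "component x m \<le> p" "component x n \<le> p"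
  then have "m \<le> p" "n \<le> p"
    using prime_above_component m n incomparable by blast+
  then show False
    using incomparable m n p \<open>m \<noteq> n\<close> by blast
qed

section \<open>Factorizations into pairwise comaximal primary elements\<close>

lemma has_CQ_factorization_if_finite_incomparable_primes:
  fixes x :: "'a::compactly_generated_mult_lattice"
  assumes "x \<noteq> 1"
    and fin: "finite {p. prime_element p \<and> x \<le> p}" (is "finite ?P")
    and incomparable:
      "\<And>p q. prime_element p \<Longrightarrow> prime_element q \<Longrightarrow> x \<le> p \<Longrightarrow> p \<le> q \<Longrightarrow> p = q"
  shows "has_CQ_factorization x"
proof -
  obtain ms where ms: "set ms = ?P" "distinct ms"
    using finite_distinct_list[OF fin] by blast
  let ?as = "map (component x) ms"
  have comax: "comaximal (component x m) (component x n)"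
    if "m \<in> set ms" "n \<in> set ms" "m \<noteq> n" for m n
    using that ms incomparable by (intro comaximal_components) auto
  have "prod_list ?as = (INF m\<in>?P. component x m)"
    using prod_list_eq_Inf_if_comaximal[OF ms(2) comax] ms(1) by simp
  moreover have "x \<le> (INF m\<in>?P. component x m)"
    by (auto intro!: INF_greatest le_component)
  ultimately have "x = prod_list ?as"
    using Inf_components_le[of x] by (simp add: antisym)
  moreover have "?as \<noteq> []"
    using exists_prime_above[OF \<open>x \<noteq> 1\<close>] ms(1) by fastforce
  moreover have "primary_element (?as ! i)" if "i < length ?as" for i
  proof -
    have "ms ! i \<in> ?P"
      using that ms(1) nth_mem[of i ms] by simp
    then show ?thesis
      using that incomparable by (simp add: primary_component)
  qed
  moreover have "comaximal (?as ! i) (?as ! j)"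
    if "i < length ?as" "j < length ?as" "i \<noteq> j" for i j
    using that comax[of "ms ! i" "ms ! j"] ms(2) by (simp add: nth_eq_iff_index_eq)
  ultimately have "CQ_factorization x ?as"
    unfolding CQ_factorization_def by (auto simp: primary_element_def)
  then show ?thesis
    unfolding has_CQ_factorization_def by blast
qed

text \<open>At most one of several pairwise comaximal factors lies below a given prime, so localizing
  at the prime \<open>m\<close> leaves only \<open>q\<close>; the cofactor \<open>s\<close> becomes invertible.\<close>

lemma CQ_factorization_primary_factor:
  fixes m :: "'a::multiplicative_lattice"
  assumes "has_CQ_factorization a" "prime_element m" "a \<le> m"
  obtains q s where "a = s * q" "primary_element q" "\<not> s \<le> m"
proof -
  obtain as where as: "CQ_factorization a as"
    using assms(1) unfolding has_CQ_factorization_def by blast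
  then obtain q where q: "q \<in> set as" "q \<le> m"
    using prime_prod_list_le assms(2,3) unfolding CQ_factorization_def by blast
  then obtain us vs where split: "as = us @ q # vs"
    by (meson split_list)
  have comax: "comaximal q b" if b: "b \<in> set (us @ vs)" for b
  proof -
    consider i where "i < length us" "b = us ! i" | i where "i < length vs" "b = vs ! i"
      using b by (auto simp: in_set_conv_nth)
    then have "\<exists>j < length as. j \<noteq> length us \<and> b = as ! j"
    proof cases
      case (1 i)
      then show ?thesis
        by (intro exI[of _ i]) (simp add: split nth_append)
    next
      case (2 i)
      then show ?thesis
        by (intro exI[of _ "Suc (length us + i)"]) (simp add: split nth_append)
    qed
    moreover have "as ! length us = q" "length us < length as"
      by (simp_all add: split)
    ultimately show ?thesis
      using as unfolding CQ_factorization_def by metis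
  qed
  have "\<not> prod_list (us @ vs) \<le> m"
  proof
    assume "prod_list (us @ vs) \<le> m"
    then obtain b where b: "b \<in> set (us @ vs)" "b \<le> m"
      using prime_prod_list_le assms(2) by blast
    then have "sup q b \<le> m"
      using q by simp
    moreover have "sup q b = 1"
      using comax[OF b(1)] by (simp add: comaximal_def)
    ultimately have "m = 1"
      by simp
    then show False
      using assms(2) by (simp add: prime_element_def)
  qed
  moreover have "a = prod_list (us @ vs) * q"
    using as by (simp add: CQ_factorization_def split ac_simps)
  moreover have "primary_element q"
    using as q(1) by (auto simp: CQ_factorization_def in_set_conv_nth)
  ultimately show ?thesis
    using that by blast
qed

lemma prime_above_CQ_factorization:
  fixes p :: "'a::multiplicative_lattice"
  assumes "CQ_factorization a as" "prime_element p" "a \<le> p"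
  shows "\<exists>q\<in>set as. primary_element q \<and> a \<le> q \<and> radical q \<le> p"
proof -
  obtain q where q: "q \<in> set as" "q \<le> p"
    using assms prime_prod_list_le unfolding CQ_factorization_def by blast
  obtain us vs where "as = us @ q # vs"
    using split_list[OF q(1)] by blast
  then have "a = prod_list (us @ vs) * q"
    using assms(1) by (simp add: CQ_factorization_def ac_simps)
  then have "a \<le> q"
    by (simp add: mult_le_right)
  moreover have "primary_element q"
    using assms(1) q(1) by (auto simp: CQ_factorization_def in_set_conv_nth)
  ultimately show ?thesis
    using q assms(2) radical_le_prime by blast
qed

section \<open>Lattice domains\<close>

text \<open>This is where the residual condition enters: it prevents the cancellation of \<open>a\<close> from
  \<open>a * b\<close>, locally at \<open>m\<close>, which primariness would force for comparable nonzero primes.\<close>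

lemma prime_eq_if_generators_factor:
  fixes G :: "'a::multiplicative_lattice set" and p m :: 'a
  assumes gen: "generates G"
    and res: "\<forall>a \<in> G - {bot}. \<forall>b \<in> G - {bot}. residual (a * b) a \<le> radical b"
    and factor: "\<forall>a \<in> G - {1}. \<forall>b \<in> G - {1}. has_CQ_factorization (a * b)"
    and p: "prime_element p" "p \<noteq> bot" and m: "prime_element m" and "p \<le> m"
  shows "p = m"
proof (rule ccontr)
  assume "p \<noteq> m"
  then have "\<not> m \<le> p"
    using \<open>p \<le> m\<close> by simp
  then obtain b where b: "b \<in> G" "b \<le> m" "\<not> b \<le> p"
    using gen by (metis generator_below_not_below)
  have "\<not> p \<le> bot"
    using p(2) by (simp add: bot_unique)
  then obtain a where a: "a \<in> G" "a \<le> p" "\<not> a \<le> bot"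
    using gen by (metis generator_below_not_below)
  have "a \<noteq> 1" "b \<noteq> 1"
    using a b p m by (auto simp: prime_element_def)
  then have "has_CQ_factorization (a * b)"
    using a b factor by blast
  moreover have ab: "a * b \<le> p"
    using a mult_le_left order_trans by blast
  ultimately obtain q s where qs: "a * b = s * q" "primary_element q" "\<not> s \<le> m"
    using m \<open>p \<le> m\<close> CQ_factorization_primary_factor order_trans by metis
  have "q \<le> p"
    using ab qs p(1) \<open>p \<le> m\<close> prime_elementD order_trans by metis
  then have "\<not> b \<le> radical q"
    using b p radical_le_prime order_trans by blast
  moreover have "a * b \<le> q"
    by (simp add: qs(1) mult_le_right)
  ultimately have "a \<le> q"
    using qs(2) by (auto simp: primary_element_def)
  then have "s * a \<le> a * b"
    by (simp add: qs(1) mult_mono_left)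
  then have "s \<le> residual (a * b) a"
    unfolding residual_def by (intro Sup_upper) simp
  also have "\<dots> \<le> radical b"
  proof -
    have "a \<in> G - {bot}" "b \<in> G - {bot}"
      using a b by auto
    then show ?thesis
      using res by blast
  qed
  also have "\<dots> \<le> m"
    using m b by (simp add: radical_le_prime)
  finally show False
    using qs by simp
qed

lemma exists_nonzero_prime:
  assumes "(UNIV :: 'a::lattice_domain set) \<noteq> {bot, 1}"
  obtains m :: "'a::lattice_domain" where "prime_element m" "m \<noteq> bot"
proof -
  obtain x :: 'a where "x \<noteq> bot" "x \<noteq> 1"
    using assms by auto
  then show ?thesis
    using that by (metis exists_prime_above bot_unique)
qed

lemma dimension_eq_one_iff:
  assumes "(UNIV :: 'a::lattice_domain set) \<noteq> {bot, 1}"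
  shows "dimension TYPE('a) = 1 \<longleftrightarrow>
    (\<forall>p q :: 'a. prime_element p \<longrightarrow> prime_element q \<longrightarrow> p \<noteq> bot \<longrightarrow> p \<le> q \<longrightarrow> p = q)"
    (is "_ \<longleftrightarrow> ?maximal")
proof -
  define chain where
    "chain n \<longleftrightarrow> (\<exists>p :: nat \<Rightarrow> 'a. (\<forall>i\<le>n. prime_element (p i)) \<and> (\<forall>i<n. p i < p (Suc i)))" for n
  have dim: "dimension TYPE('a) = Sup {enat n | n. chain n}"
    unfolding dimension_def chain_def ..
  show ?thesis
  proof
    assume one: "dimension TYPE('a) = 1"
    show ?maximal
    proof (intro allI impI, rule ccontr)
      fix p q :: 'a
      assume pq: "prime_element p" "prime_element q" "p \<noteq> bot" "p \<le> q" "p \<noteq> q"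
      define c where "c = (\<lambda>i::nat. if i = 0 then bot else if i = 1 then p else q)"
      have "chain 2"
        unfolding chain_def
        by (rule exI[of _ c])
          (use pq prime_bot in
            \<open>auto simp: c_def bot.not_eq_extremum less_Suc_eq numeral_2_eq_2\<close>)
      then have "enat 2 \<le> dimension TYPE('a)"
        unfolding dim by (intro Sup_upper) blast
      then show False
        by (simp add: one one_enat_def)
    qed
  next
    assume maximal: ?maximal
    have "enat n \<le> 1" if "chain n" for n
    proof (rule ccontr)
      assume "\<not> enat n \<le> 1"
      then have n: "2 \<le> n"
        by (simp add: one_enat_def)
      obtain p :: "nat \<Rightarrow> 'a" where
        p: "\<And>i. i \<le> n \<Longrightarrow> prime_element (p i)" "\<And>i. i < n \<Longrightarrow> p i < p (Suc i)"
        using \<open>chain n\<close> unfolding chain_def by blast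
      have "p 0 < p 1" "p 1 < p 2" "prime_element (p 1)" "prime_element (p 2)"
        using n p(1)[of 1] p(1)[of 2] p(2)[of 0] p(2)[of 1] by (auto simp: numeral_2_eq_2)
      then show False
        using maximal by (metis less_le not_less_bot)
    qed
    then have "dimension TYPE('a) \<le> 1"
      unfolding dim by (auto intro: Sup_least)
    moreover obtain m :: 'a where "prime_element m" "m \<noteq> bot"
      using exists_nonzero_prime[OF assms] .
    then have "chain 1"
      unfolding chain_def using prime_bot
      by (intro exI[of _ "\<lambda>i::nat. if i = 0 then bot else m"]) (auto simp: bot.not_eq_extremum)
    then have "1 \<le> dimension TYPE('a)"
      unfolding dim by (intro Sup_upper) (auto simp: one_enat_def)
    ultimately show "dimension TYPE('a) = 1"
      by simp
  qed
qed

lemma finite_Min_primes_if_generators_factor: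
  fixes G :: "'a::lattice_domain set"
  assumes gen: "generates G"
    and factor: "\<forall>a \<in> G - {1}. \<forall>b \<in> G - {1}. has_CQ_factorization (a * b)"
    and maximal: "\<And>p q :: 'a. prime_element p \<Longrightarrow> prime_element q \<Longrightarrow> p \<noteq> bot \<Longrightarrow> p \<le> q \<Longrightarrow> p = q"
  shows "finite (Min_primes (a::'a))"
proof (cases "a = bot")
  case True
  then have "Min_primes a \<subseteq> {bot}"
    using prime_bot by (auto simp: Min_primes_def)
  then show ?thesis
    by (rule finite_subset) simp
next
  case False
  then have "\<not> a \<le> bot"
    by (simp add: bot_unique)
  then obtain g where g: "g \<in> G" "g \<le> a" "\<not> g \<le> bot"
    using gen by (metis generator_below_not_below)
  show ?thesis
  proof (cases "g = 1")
    case True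
    then have "Min_primes a = {}"
      using g by (auto simp: Min_primes_def prime_element_def)
    then show ?thesis by simp
  next
    case False
    then obtain as where as: "CQ_factorization (g * g) as"
      using factor g unfolding has_CQ_factorization_def by blast
    have "\<not> g * g \<le> bot"
      using prime_elementD[OF prime_bot] g by blast
    have "Min_primes a \<subseteq> radical ` set as"
    proof
      fix p assume "p \<in> Min_primes a"
      then have p: "prime_element p" "g * g \<le> p"
        using g mult_le_left[of g g] unfolding Min_primes_def by (auto intro: order_trans)
      then obtain q where q: "q \<in> set as" "primary_element q" "g * g \<le> q" "radical q \<le> p"
        using prime_above_CQ_factorization[OF as] by blast
      have "radical q \<noteq> bot"
        using q(3) \<open>\<not> g * g \<le> bot\<close> le_radical[of q] by (metis order_trans)
      then have "radical q = p"
        using maximal p q prime_radical_of_primary by blast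
      then show "p \<in> radical ` set as"
        using q by blast
    qed
    then show ?thesis
      by (rule finite_subset) simp
  qed
qed

lemma CQ_lattice_if_primes_maximal:
  assumes maximal: "\<And>p q :: 'a::lattice_domain.
      prime_element p \<Longrightarrow> prime_element q \<Longrightarrow> p \<noteq> bot \<Longrightarrow> p \<le> q \<Longrightarrow> p = q"
    and fin: "\<And>a :: 'a::lattice_domain. finite (Min_primes a)"
  shows "CQ_lattice TYPE('a)"
  unfolding CQ_lattice_def
proof (intro allI impI)
  fix x :: 'a
  assume "x \<noteq> 1"
  show "has_CQ_factorization x"
  proof (cases "x = bot")
    case True
    have "primary_element (bot :: 'a)"
      using prime_bot le_radical[of "bot::'a"]
      unfolding primary_element_def prime_element_def by (meson order_trans)
    then have "CQ_factorization bot [bot :: 'a]"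
      by (simp add: CQ_factorization_def bot_neq_one)
    with True show ?thesis
      unfolding has_CQ_factorization_def by blast
  next
    case False
    have incomparable: "p = q" if "prime_element p" "prime_element q" "x \<le> p" "p \<le> q" for p q
      using maximal[of p q] that False bot_unique[of x] by (cases "p = bot") simp_all
    have "{p. prime_element p \<and> x \<le> p} \<subseteq> Min_primes x"
      using incomparable by (auto simp: Min_primes_def)
    then have "finite {p. prime_element p \<and> x \<le> p}"
      using fin finite_subset by blast
    then show ?thesis
      using \<open>x \<noteq> 1\<close> incomparable by (intro has_CQ_factorization_if_finite_incomparable_primes)
  qed
qed

theorem theorem20:
  fixes G :: "'a::lattice_domain set"
  assumes nontrivial: "(UNIV :: 'a set) \<noteq> {bot, 1}"
    and gen: "generates G"
    and res: "\<forall>a \<in> G - {bot}. \<forall>b \<in> G - {bot}. residual (a * b) a \<le> radical b"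
  shows "((\<forall>a \<in> G - {1}. \<forall>b \<in> G - {1}. has_CQ_factorization (a * b))
            \<longleftrightarrow> (dimension TYPE('a) = 1 \<and> (\<forall>a::'a. finite (Min_primes a))))
       \<and> ((dimension TYPE('a) = 1 \<and> (\<forall>a::'a. finite (Min_primes a)))
            \<longleftrightarrow> CQ_lattice TYPE('a))"
    (is "(?i \<longleftrightarrow> ?ii) \<and> (_ \<longleftrightarrow> ?iii)")
proof -
  have "?ii" if ?i
  proof -
    have maximal: "p = q" if "prime_element p" "prime_element q" "p \<noteq> bot" "p \<le> q" for p q :: 'a
      using prime_eq_if_generators_factor[OF gen res \<open>?i\<close>] that by blast
    then have "dimension TYPE('a) = 1"
      using dimension_eq_one_iff[OF nontrivial] by blast
    moreover have "finite (Min_primes a)" for a :: 'a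
      using finite_Min_primes_if_generators_factor[OF gen \<open>?i\<close>] maximal by blast
    ultimately show ?ii by blast
  qed
  moreover have "?iii" if ?ii
  proof -
    have "p = q" if "prime_element p" "prime_element q" "p \<noteq> bot" "p \<le> q" for p q :: 'a
      using dimension_eq_one_iff[OF nontrivial] \<open>?ii\<close> that by blast
    then show ?iii
      using \<open>?ii\<close> by (intro CQ_lattice_if_primes_maximal) blast+
  qed
  moreover have "?i" if ?iii
  proof (intro ballI)
    fix a b assume "a \<in> G - {1}" "b \<in> G - {1}"
    then have "a * b \<noteq> 1"
      using mult_le_left[of a b] by auto
    then show "has_CQ_factorization (a * b)"
      using \<open>?iii\<close> unfolding CQ_lattice_def by blast
  qed
  ultimately show ?thesis by blast
qed

end
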